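(* If $f:A\to B$ and $g:C\to D$ are morphisms of $\mathbf{HRAMnet}$ (with disjoint port names), then $[\![f\otimes g]\!]=[\![f]\!]\otimes[\![g]\!]$.
   Context: Port names and interfaces. Fix disjoint countably infinite sets $\mathbb A$ (port names) and $\mathbb P$ (pointer names). Polarities $L=\{O,P\}$, $O^*=P$, $P^*=O$. A port is $(l,a)\in L\times\mathbb A$. An interface is a finite set $A$ of ports with no repeated port name; $\mathrm{sup}(A)$ its port names; $A^{(O)}$, $A^{(P)}$ its $O$-/$P$-labelled ports. For disjoint supports $A\otimes B=A\cup B$; $A^*=\{(l^*,a)\mid(l,a)\in A\}$; $A\Rightarrow B=A^*\otimes B$. Machines and nets. Data $\mathcal D=\{\emptyset\}\cup\mathbb P\cup\mathbb Z$; fixed $r_m\le r$. Engines $E=(A,P)$: interface $A$ plus a map $P$ from $\mathrm{sup}(A^{(O)})$ to code fragments over instructions $\mathtt{new},\mathtt{get},\mathtt{update},\mathtt{free},\mathtt{flip},\mathtt{set}$ (manipulating $r$ thread registers and a shared heap $\mathbb P\rightharpoonup\mathbb P\times\mathcal D$), with control $\mathtt{ifzero}$, $\mathtt{end}$, and $\mathtt{spark}\ a$ (only for $(P,a)\in A$). Engines run multiple threads; on input message $(a,\vec d)\in\mathbb A\times\mathcal D^{r_m}$ at $(O,a)\in A$ a thread running $P(a)$ with registers $\vec d$ (padded with $\emptyset$) starts; $\mathtt{spark}\ a$ jumps to $P(\chi(a))$ (passing the first $r_m$ registers) if $\chi(a)$ is an input port of the same engine, and otherwise terminates the thread and emits $(\chi(a),(d_0,\dots,d_{r_m-1}))$.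 An HRAM net $S=(\vec E,\chi,A)$ consists of engines with pairwise disjoint interface supports, external interface $A$, and a bijection $\chi:\mathrm{sup}(A^{(O)}\otimes A_{\vec E}^{(P)})\to\mathrm{sup}(A^{(P)}\otimes A_{\vec E}^{(O)})$ ($A_{\vec E}$ the tensor of the engine interfaces). Emitted messages go into a pool from which engines receive; pending messages at $(P,a)\in A$ may be observably output with label $(P,(a,\vec d))$; an observable input $(O,(a,\vec d))$ at $(O,a)\in A$ adds $(\chi(a),\vec d)$ to the pool. A trace over $A$ is a finite sequence of polarised messages with port names in $\mathrm{sup}(A)$; $[\![S]\!]$ is the set of traces of observable labels performed from the initial configuration (no threads, empty heaps, empty pool) with silent steps interspersed. Morphisms $f:A\to B$ of $\mathbf{HRAMnet}$ are nets with external interface $A\Rightarrow B$. For $f=(\vec E_f,\chi_f,A\Rightarrow B)$ and $g=(\vec E_g,\chi_g,C\Rightarrow D)$, $f\otimes g=(\vec E_f\cup\vec E_g,\chi_f\cup\chi_g,A\otimes C\Rightarrow B\otimes D)$. Trace operations: for a trace $s$ and interface $X$, $s-X$ deletes all messages whose port name is in $\mathrm{sup}(X)$. For $S_1$ a set of traces over $X$ and $S_2$ a set of traces over $Y$ (disjoint supports), the interleaving is $S_1\otimes S_2=\{s \text{ trace over } X\otimes Y\mid s-Y\in S_1,\ s-X\in S_2\}$. *)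

theory Defs
  imports Main "HOL-Library.Multiset"
begin

datatype port_name = Port_Name nat
datatype ptr_name = Ptr_Name nat

datatype polarity = Opp | Prop

primrec dual_pol :: "polarity \<Rightarrow> polarity" where
  "dual_pol Opp = Prop"
| "dual_pol Prop = Opp"

type_synonym port = "polarity \<times> port_name"
type_synonym interface = "port set"

definition is_interface :: "interface \<Rightarrow> bool" where
  "is_interface A \<longleftrightarrow> finite A \<and> inj_on snd A"

definition supp :: "interface \<Rightarrow> port_name set" where
  "supp A = snd ` A"

definition restr :: "polarity \<Rightarrow> interface \<Rightarrow> interface" where
  "restr l A = {p \<in> A. fst p = l}"

definition dual :: "interface \<Rightarrow> interface" where
  "dual A = (\<lambda>(l, a). (dual_pol l, a)) ` A"

text \<open>The tensor of interfaces is only meaningful for disjoint supports; the disjointness is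
  imposed wherever the operation is used.\<close>

definition tensorI :: "interface \<Rightarrow> interface \<Rightarrow> interface" where
  "tensorI A B = A \<union> B"

definition arrowI :: "interface \<Rightarrow> interface \<Rightarrow> interface" where
  "arrowI A B = tensorI (dual A) B"

datatype data = Null | Pointer ptr_name | Integer int

type_synonym heap = "ptr_name \<Rightarrow> (ptr_name \<times> data) option"

text \<open>Vectors of data are lists: register files have length \<open>r\<close> and messages have length \<open>rm\<close>.
  The global constants \<open>r\<close> and \<open>rm\<close> are explicit parameters of the definitions below.\<close>

type_synonym regs = "data list"
type_synonym message = "port_name \<times> data list"
type_synonym pmessage = "polarity \<times> message"

text \<open>The operand \<open>None\<close> is the null register: it reads as \<open>Null\<close> and discards what is written.\<close>

type_synonym operand = "nat option"

datatype instr =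
    New operand operand operand  \<comment> \<open>\<open>i \<leftarrow> new j, k\<close>\<close>
  | Get operand operand operand  \<comment> \<open>\<open>i, j \<leftarrow> get k\<close>\<close>
  | Update operand operand
  | Free operand
  | Flip operand operand
  | SetReg operand "int option"  \<comment> \<open>the constant \<open>None\<close> stands for \<open>Null\<close>\<close>

datatype code =
    Seq instr code
  | IfZero nat code code
  | Spark port_name
  | End

primrec sparks :: "code \<Rightarrow> port_name set" where
  "sparks (Seq i c) = sparks c"
| "sparks (IfZero n c1 c2) = sparks c1 \<union> sparks c2"
| "sparks (Spark a) = {a}"
| "sparks End = {}"

record engine =
  eiface :: interface
  prog :: "port_name \<Rightarrow> code option"

definition is_engine :: "engine \<Rightarrow> bool" where
  "is_engine E \<longleftrightarrow>
     is_interface (eiface E) \<and>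
     dom (prog E) = supp (restr Opp (eiface E)) \<and>
     (\<forall>c \<in> ran (prog E). \<forall>a \<in> sparks c. (Prop, a) \<in> eiface E)"

text \<open>Register accesses outside the register file are undefined; an instruction performing one,
  or using a datum of the wrong kind as a pointer, has no transition.\<close>

fun rd :: "regs \<Rightarrow> operand \<Rightarrow> data option" where
  "rd d None = Some Null"
| "rd d (Some i) = (if i < length d then Some (d ! i) else None)"

fun wr :: "regs \<Rightarrow> operand \<Rightarrow> data \<Rightarrow> regs option" where
  "wr d None v = Some d"
| "wr d (Some i) v = (if i < length d then Some (d[i := v]) else None)"

inductive exec :: "instr \<Rightarrow> regs \<times> heap \<Rightarrow> regs \<times> heap \<Rightarrow> bool" where
  exec_new:
    "\<lbrakk>rd d j = Some (Pointer q); rd d k = Some v; p \<notin> dom h; wr d i (Pointer p) = Some d'\<rbrakk>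
     \<Longrightarrow> exec (New i j k) (d, h) (d', h(p \<mapsto> (q, v)))"
| exec_get:
    "\<lbrakk>rd d k = Some (Pointer p); h p = Some (q, v);
      wr d i (Pointer q) = Some d'; wr d' j v = Some d''\<rbrakk>
     \<Longrightarrow> exec (Get i j k) (d, h) (d'', h)"
| exec_update:
    "\<lbrakk>rd d i = Some (Pointer p); h p = Some (q, w); rd d j = Some v\<rbrakk>
     \<Longrightarrow> exec (Update i j) (d, h) (d, h(p \<mapsto> (q, v)))"
| exec_free:
    "\<lbrakk>rd d i = Some (Pointer p); p \<in> dom h; wr d i Null = Some d'\<rbrakk>
     \<Longrightarrow> exec (Free i) (d, h) (d', h(p := None))"
| exec_flip:
    "\<lbrakk>rd d i = Some v; rd d j = Some w; wr d i w = Some d'; wr d' j v = Some d''\<rbrakk>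
     \<Longrightarrow> exec (Flip i j) (d, h) (d'', h)"
| exec_set:
    "wr d i (case n of None \<Rightarrow> Null | Some z \<Rightarrow> Integer z) = Some d'
     \<Longrightarrow> exec (SetReg i n) (d, h) (d', h)"

definition pad :: "nat \<Rightarrow> data list \<Rightarrow> regs" where
  "pad r d = d @ replicate (r - length d) Null"

type_synonym thread = "code \<times> regs"
type_synonym econf = "thread multiset \<times> heap"

type_synonym conn = "port_name \<Rightarrow> port_name option"

text \<open>Labels of transitions: \<open>None\<close> is a silent step, \<open>Some (l, m)\<close> a polarised message.\<close>

inductive estep ::
  "nat \<Rightarrow> nat \<Rightarrow> conn \<Rightarrow> engine \<Rightarrow> econf \<Rightarrow> pmessage option \<Rightarrow> econf \<Rightarrow> bool"
  for r rm \<chi> E where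
  estep_instr:
    "exec i (d, h) (d', h')
     \<Longrightarrow> estep r rm \<chi> E (add_mset (Seq i c, d) ts, h) None (add_mset (c, d') ts, h')"
| estep_zero:
    "rd d (Some i) = Some (Integer 0)
     \<Longrightarrow> estep r rm \<chi> E (add_mset (IfZero i c1 c2, d) ts, h) None (add_mset (c1, d) ts, h)"
| estep_nonzero:
    "\<lbrakk>rd d (Some i) = Some v; v \<noteq> Integer 0\<rbrakk>
     \<Longrightarrow> estep r rm \<chi> E (add_mset (IfZero i c1 c2, d) ts, h) None (add_mset (c2, d) ts, h)"
| estep_end:
    "estep r rm \<chi> E (add_mset (End, d) ts, h) None (ts, h)"
| estep_jump:
    "\<lbrakk>\<chi> a = Some b; (Opp, b) \<in> eiface E; prog E b = Some c\<rbrakk>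
     \<Longrightarrow> estep r rm \<chi> E (add_mset (Spark a, d) ts, h) None
           (add_mset (c, pad r (take rm d)) ts, h)"
| estep_send:
    "\<lbrakk>\<chi> a = Some b; (Opp, b) \<notin> eiface E\<rbrakk>
     \<Longrightarrow> estep r rm \<chi> E (add_mset (Spark a, d) ts, h) (Some (Prop, (b, take rm d))) (ts, h)"
| estep_receive:
    "\<lbrakk>(Opp, a) \<in> eiface E; prog E a = Some c; length d = rm\<rbrakk>
     \<Longrightarrow> estep r rm \<chi> E (ts, h) (Some (Opp, (a, d))) (add_mset (c, pad r d) ts, h)"

record net =
  engines :: "engine set"
  conn_of :: conn
  iface :: interface

definition engines_iface :: "engine set \<Rightarrow> interface" where
  "engines_iface Es = (\<Union>E \<in> Es. eiface E)"

definition is_net :: "net \<Rightarrow> bool" where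
  "is_net S \<longleftrightarrow>
     (let A = iface S; AE = engines_iface (engines S);
          src = tensorI (restr Opp A) (restr Prop AE);
          tgt = tensorI (restr Prop A) (restr Opp AE)
      in finite (engines S) \<and> (\<forall>E \<in> engines S. is_engine E) \<and>
         (\<forall>E \<in> engines S. \<forall>E' \<in> engines S. E \<noteq> E' \<longrightarrow> supp (eiface E) \<inter> supp (eiface E') = {}) \<and>
         is_interface A \<and>
         supp (restr Opp A) \<inter> supp (restr Prop AE) = {} \<and>
         supp (restr Prop A) \<inter> supp (restr Opp AE) = {} \<and>
         dom (conn_of S) = supp src \<and>
         bij_betw (\<lambda>a. the (conn_of S a)) (supp src) (supp tgt))"

text \<open>A net configuration assigns an engine configuration to every engine (values outside
  \<open>engines S\<close> are irrelevant) and contains the pool of pending messages.\<close>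

type_synonym nconf = "(engine \<Rightarrow> econf) \<times> message multiset"

definition initial :: nconf where
  "initial = ((\<lambda>E. ({#}, Map.empty)), {#})"

inductive nstep :: "nat \<Rightarrow> nat \<Rightarrow> net \<Rightarrow> nconf \<Rightarrow> pmessage option \<Rightarrow> nconf \<Rightarrow> bool"
  for r rm S where
  nstep_silent:
    "\<lbrakk>E \<in> engines S; estep r rm (conn_of S) E (K E) None k\<rbrakk>
     \<Longrightarrow> nstep r rm S (K, ms) None (K(E := k), ms)"
| nstep_send:
    "\<lbrakk>E \<in> engines S; estep r rm (conn_of S) E (K E) (Some (Prop, m)) k\<rbrakk>
     \<Longrightarrow> nstep r rm S (K, ms) None (K(E := k), add_mset m ms)"
| nstep_receive:
    "\<lbrakk>E \<in> engines S; estep r rm (conn_of S) E (K E) (Some (Opp, m)) k\<rbrakk>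
     \<Longrightarrow> nstep r rm S (K, add_mset m ms) None (K(E := k), ms)"
| nstep_output:
    "(Prop, a) \<in> iface S
     \<Longrightarrow> nstep r rm S (K, add_mset (a, d) ms) (Some (Prop, (a, d))) (K, ms)"
| nstep_input:
    "\<lbrakk>(Opp, a) \<in> iface S; conn_of S a = Some b; length d = rm\<rbrakk>
     \<Longrightarrow> nstep r rm S (K, ms) (Some (Opp, (a, d))) (K, add_mset (b, d) ms)"

type_synonym trace = "pmessage list"

inductive run :: "nat \<Rightarrow> nat \<Rightarrow> net \<Rightarrow> nconf \<Rightarrow> trace \<Rightarrow> nconf \<Rightarrow> bool"
  for r rm S where
  run_nil: "run r rm S n [] n"
| run_silent: "\<lbrakk>nstep r rm S n None n'; run r rm S n' s n''\<rbrakk> \<Longrightarrow> run r rm S n s n''"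
| run_obs: "\<lbrakk>nstep r rm S n (Some \<alpha>) n'; run r rm S n' s n''\<rbrakk> \<Longrightarrow> run r rm S n (\<alpha> # s) n''"

definition denot :: "nat \<Rightarrow> nat \<Rightarrow> net \<Rightarrow> trace set" where
  "denot r rm S = {s. \<exists>n. run r rm S initial s n}"

definition traces :: "nat \<Rightarrow> interface \<Rightarrow> trace set" where
  "traces rm A = {s. \<forall>(l, a, d) \<in> set s. a \<in> supp A \<and> length d = rm}"

definition tr_minus :: "trace \<Rightarrow> interface \<Rightarrow> trace" where
  "tr_minus s X = filter (\<lambda>(l, a, d). a \<notin> supp X) s"

definition interleave ::
  "nat \<Rightarrow> interface \<Rightarrow> interface \<Rightarrow> trace set \<Rightarrow> trace set \<Rightarrow> trace set" where
  "interleave rm X Y S1 S2 =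
     {s \<in> traces rm (tensorI X Y). tr_minus s Y \<in> S1 \<and> tr_minus s X \<in> S2}"

definition is_morphism :: "net \<Rightarrow> interface \<Rightarrow> interface \<Rightarrow> bool" where
  "is_morphism f A B \<longleftrightarrow>
     is_interface A \<and> is_interface B \<and> supp A \<inter> supp B = {} \<and> is_net f \<and> iface f = arrowI A B"

text \<open>All port names of a net: those of its external interface and those of its engines.\<close>

definition net_names :: "net \<Rightarrow> port_name set" where
  "net_names S = supp (iface S) \<union> supp (engines_iface (engines S))"

text \<open>For morphisms with disjoint port names the maps have disjoint domains, so that \<open>++\<close> is
  their union.\<close>

definition tensor_mor ::
  "interface \<Rightarrow> interface \<Rightarrow> interface \<Rightarrow> interface \<Rightarrow> net \<Rightarrow> net \<Rightarrow> net" where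
  "tensor_mor A B C D f g =
     \<lparr>engines = engines f \<union> engines g,
      conn_of = conn_of f ++ conn_of g,
      iface = arrowI (tensorI A C) (tensorI B D)\<rparr>"

end

theory Submission imports Defs begin

text \<open>A configuration of the tensor splits into a configuration of each factor: the engines are
  independent, and the pool is divided by port names. Steps of the tensor correspond exactly to
  steps of one factor, provided that threads only mention ports of their own engine, so that
  the other half of the connection map is never consulted. Hence runs of the tensor are
  interleavings of runs of the factors.\<close>

text \<open>An engine with the empty interface may belong to both factors; the last conjunct ensures
  that such an engine never steps.\<close>

definition thread_ok :: "nat \<Rightarrow> engine \<Rightarrow> thread \<Rightarrow> bool" where
  "thread_ok r E t \<longleftrightarrow>
     length (snd t) = r \<and> (\<forall>a \<in> sparks (fst t). (Prop, a) \<in> eiface E) \<and> eiface E \<noteq> {}"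

text \<open>Invariant of reachable configurations. Its pool clause makes the division of a joint
  pool unambiguous when the nets share no names; message lengths are recorded because
  \<open>nstep_output\<close> does not check them.\<close>

definition conf_ok :: "nat \<Rightarrow> nat \<Rightarrow> net \<Rightarrow> nconf \<Rightarrow> bool" where
  "conf_ok r rm S n \<longleftrightarrow>
     (\<forall>E \<in> engines S. \<forall>t \<in># fst (fst n E). thread_ok r E t) \<and>
     (\<forall>m \<in># snd n. fst m \<in> net_names S \<and> length (snd m) = rm)"

section \<open>Port names of a net\<close>

lemma suppI: "(l, a) \<in> X \<Longrightarrow> a \<in> supp X"
  unfolding supp_def by force

lemma supp_Un [simp]: "supp (X \<union> Y) = supp X \<union> supp Y"
  unfolding supp_def by auto

lemma supp_restr: "supp (restr l X) \<subseteq> supp X"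
  unfolding supp_def restr_def by auto

lemma iface_net_names: "(l, a) \<in> iface S \<Longrightarrow> a \<in> net_names S"
  unfolding net_names_def by (auto dest: suppI)

lemma eiface_net_names: "E \<in> engines S \<Longrightarrow> (l, a) \<in> eiface E \<Longrightarrow> a \<in> net_names S"
  unfolding net_names_def engines_iface_def by (auto intro: suppI)

lemma is_net_engine: "is_net S \<Longrightarrow> E \<in> engines S \<Longrightarrow> is_engine E"
  unfolding is_net_def by (auto simp: Let_def)

lemma is_net_conn:
  assumes "is_net S" "conn_of S a = Some b"
  shows "a \<in> net_names S" "b \<in> net_names S"
proof -
  let ?A = "iface S" and ?AE = "engines_iface (engines S)"
  let ?src = "supp (tensorI (restr Opp ?A) (restr Prop ?AE))"
  let ?tgt = "supp (tensorI (restr Prop ?A) (restr Opp ?AE))"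
  have d: "dom (conn_of S) = ?src" and b: "bij_betw (\<lambda>a. the (conn_of S a)) ?src ?tgt"
    using assms(1) unfolding is_net_def Let_def by blast+
  have a: "a \<in> ?src" using assms(2) d by blast
  then have "the (conn_of S a) \<in> ?tgt" using bij_betwE[OF b] by blast
  then have "b \<in> ?tgt" using assms(2) by simp
  with a show "a \<in> net_names S" "b \<in> net_names S"
    using supp_restr unfolding net_names_def tensorI_def supp_Un by blast+
qed

section \<open>Engine steps and well-formed threads\<close>

lemma wr_length: "wr d i v = Some d' \<Longrightarrow> length d' = length d"
  by (cases i) (auto split: if_splits)

lemma exec_length:
  assumes "exec i (d, h) (d', h')"
  shows "length d' = length d"
  using assms by cases (auto dest!: wr_length)

lemma length_pad: "length d \<le> r \<Longrightarrow> length (pad r d) = r"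
  by (simp add: pad_def)

lemma thread_ok_start:
  assumes "is_engine E" "prog E b = Some c" "(Opp, b) \<in> eiface E" "length d \<le> r"
  shows "thread_ok r E (c, pad r d)"
  using assms by (auto simp: thread_ok_def is_engine_def length_pad intro: ranI)

text \<open>New code enters only by a jump or a receipt, where \<open>is_engine\<close> bounds its
  sparks. Every other step keeps a subterm of the old code and the length of the register
  file.\<close>

lemma estep_thread_ok:
  assumes "estep r rm \<chi> E k \<alpha> k'" "is_engine E" "rm \<le> r" "\<forall>t \<in># fst k. thread_ok r E t"
  shows "\<forall>t \<in># fst k'. thread_ok r E t"
  using assms
proof cases
  case (estep_jump a b c d ts h)
  then show ?thesis using assms thread_ok_start[of E b c "take rm d" r] by auto
next
  case (estep_receive a c d ts h)
  then show ?thesis using assms thread_ok_start[of E a c d r] by auto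
qed (auto simp: thread_ok_def dest: exec_length)

text \<open>A step either consumes a thread, which \<open>thread_ok\<close> allows only on a
  nonempty interface, or receives at an input port of the interface.\<close>

lemma estep_active:
  assumes "estep r rm \<chi> E k \<alpha> k'" "\<forall>t \<in># fst k. thread_ok r E t"
  shows "eiface E \<noteq> {}"
  using assms by cases (auto simp: thread_ok_def)

lemma estep_send_message:
  assumes "estep r rm \<chi> E k (Some (Prop, m)) k'" "rm \<le> r" "\<forall>t \<in># fst k. thread_ok r E t"
  shows "fst m \<in> ran \<chi> \<and> length (snd m) = rm"
  using assms by cases (auto simp: thread_ok_def intro: ranI)

lemma estep_receive_port:
  assumes "estep r rm \<chi> E k (Some (Opp, m)) k'"
  shows "(Opp, fst m) \<in> eiface E"
  using assms by cases auto

text \<open>An engine consults the connection map only at the ports its threads spark, and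
  \<open>thread_ok\<close> places these among its own output ports.\<close>

lemma estep_conn_cong:
  assumes "estep r rm \<chi> E k \<alpha> k'" "\<forall>t \<in># fst k. thread_ok r E t"
    and "\<And>a. (Prop, a) \<in> eiface E \<Longrightarrow> \<chi>' a = \<chi> a"
  shows "estep r rm \<chi>' E k \<alpha> k'"
  using assms by cases (auto simp: thread_ok_def intro: estep.intros)

section \<open>The invariant along net steps\<close>

lemma nstep_conf_ok:
  assumes "nstep r rm S n \<alpha> n'" "is_net S" "rm \<le> r" "conf_ok r rm S n"
  shows "conf_ok r rm S n'"
  using assms(1)
proof cases
  case (nstep_silent E K k ms)
  then show ?thesis
    using assms(3,4) estep_thread_ok[OF nstep_silent(5) is_net_engine[OF assms(2)]]
    by (auto simp: conf_ok_def)
next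
  case (nstep_send E K m k ms)
  have ok: "\<forall>t \<in># fst (K E). thread_ok r E t"
    using assms(4) nstep_send by (auto simp: conf_ok_def)
  have "fst m \<in> net_names S \<and> length (snd m) = rm"
    using estep_send_message[OF nstep_send(5) assms(3) ok] is_net_conn(2)[OF assms(2)]
    by (auto simp: ran_def)
  then show ?thesis
    using assms(4) nstep_send estep_thread_ok[OF nstep_send(5) is_net_engine[OF assms(2)] assms(3) ok]
    by (auto simp: conf_ok_def)
next
  case (nstep_receive E K m k ms)
  then show ?thesis
    using assms(3,4) estep_thread_ok[OF nstep_receive(5) is_net_engine[OF assms(2)]]
    by (auto simp: conf_ok_def)
next
  case (nstep_input a b d K ms)
  then show ?thesis using assms(4) is_net_conn(2)[OF assms(2)] by (auto simp: conf_ok_def)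
qed (use assms(4) in \<open>auto simp: conf_ok_def\<close>)

lemma nstep_label:
  assumes "nstep r rm S n (Some (l, a, d)) n'" "conf_ok r rm S n"
  shows "(l, a) \<in> iface S" "length d = rm"
  using assms by (cases; auto simp: conf_ok_def)+

text \<open>Stated as a relation rather than a function so that it is symmetric in the two nets, also
  on shared engines.\<close>

definition joins ::
  "nat \<Rightarrow> nat \<Rightarrow> net \<Rightarrow> net \<Rightarrow> nconf \<Rightarrow> nconf \<Rightarrow> nconf \<Rightarrow> bool" where
  "joins r rm f g n n1 n2 \<longleftrightarrow>
     conf_ok r rm f n1 \<and> conf_ok r rm g n2 \<and> snd n = snd n1 + snd n2 \<and>
     (\<forall>E \<in> engines f. fst n E = fst n1 E) \<and> (\<forall>E \<in> engines g. fst n E = fst n2 E)"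

lemma joins_sym: "joins r rm f g n n1 n2 \<longleftrightarrow> joins r rm g f n n2 n1"
  unfolding joins_def by (auto simp: add.commute)

lemma joins_initial: "joins r rm f g initial initial initial"
  by (simp add: joins_def conf_ok_def initial_def)

text \<open>The net \<open>h\<close> is described only by properties symmetric in \<open>f\<close>
  and \<open>g\<close>, whereas \<open>tensor_mor\<close> is built with \<open>++\<close>, which
  favours its right argument. By \<open>swap\<close>, statements proved for \<open>f\<close> then
  carry over to \<open>g\<close>.\<close>

locale net_tensor =
  fixes r rm :: nat and f g h :: net
  assumes rm_le: "rm \<le> r"
    and net_f: "is_net f" and net_g: "is_net g"
    and disj: "net_names f \<inter> net_names g = {}"
    and engines_h: "engines h = engines f \<union> engines g"
    and conn_f: "\<And>a. a \<in> net_names f \<Longrightarrow> conn_of h a = conn_of f a"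
    and conn_g: "\<And>a. a \<in> net_names g \<Longrightarrow> conn_of h a = conn_of g a"
    and iface_h: "iface h = iface f \<union> iface g"
begin

section \<open>Joined configurations and single engines\<close>

lemma swap: "net_tensor r rm g f h"
  using rm_le net_f net_g disj engines_h conn_f conn_g iface_h by unfold_locales auto

lemma not_shared:
  assumes "E \<in> engines f" "eiface E \<noteq> {}"
  shows "E \<notin> engines g"
proof
  assume "E \<in> engines g"
  moreover obtain l a where "(l, a) \<in> eiface E" using assms(2) by fastforce
  ultimately show False using eiface_net_names assms(1) disj by blast
qed

text \<open>The nonempty interface is essential: by \<open>not_shared\<close> it keeps the update
  away from the engines of \<open>g\<close>.\<close>

lemma joins_upd:
  assumes "joins r rm f g (K, ms) (K1, ms1) n2" "E \<in> engines f" "eiface E \<noteq> {}"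
    and "conf_ok r rm f (K1(E := k), ms1')" "ms' = ms1' + snd n2"
  shows "joins r rm f g (K(E := k), ms') (K1(E := k), ms1') n2"
  using assms not_shared by (auto simp: joins_def)

lemma joins_engine_step:
  assumes "joins r rm f g (K, ms) (K1, ms1) n2" "E \<in> engines f"
  shows "estep r rm (conn_of h) E (K E) \<alpha> k \<longleftrightarrow> estep r rm (conn_of f) E (K1 E) \<alpha> k"
proof -
  have K: "K E = K1 E" and ok: "\<forall>t \<in># fst (K1 E). thread_ok r E t"
    using assms by (auto simp: joins_def conf_ok_def)
  have "conn_of h a = conn_of f a" if "(Prop, a) \<in> eiface E" for a
    using conn_f eiface_net_names[OF assms(2) that] .
  then show ?thesis unfolding K
    using estep_conn_cong[OF _ ok, of rm "conn_of h" \<alpha> k "conn_of f"]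
      estep_conn_cong[OF _ ok, of rm "conn_of f" \<alpha> k "conn_of h"] by auto
qed

lemma joins_active:
  assumes "joins r rm f g (K, ms) (K1, ms1) n2" "E \<in> engines f"
    and "estep r rm (conn_of f) E (K1 E) \<alpha> k"
  shows "eiface E \<noteq> {}"
  using assms estep_active[OF assms(3)] by (auto simp: joins_def conf_ok_def)

section \<open>Net steps of the tensor and of its factors\<close>

text \<open>The two connection maps agree on the names of \<open>f\<close>, and no rule of
  \<open>nstep\<close> has a condition that further engines, external ports or pending messages
  could violate.\<close>

lemma step_lift:
  assumes j: "joins r rm f g n n1 n2" and st: "nstep r rm f n1 \<alpha> n1'"
  shows "\<exists>n'. nstep r rm h n \<alpha> n' \<and> joins r rm f g n' n1' n2"
proof -
  obtain K ms where n: "n = (K, ms)" by (cases n)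
  have ok: "conf_ok r rm f n1'"
    using nstep_conf_ok[OF st net_f rm_le] j by (simp add: joins_def)
  have ms: "ms = snd n1 + snd n2" using j by (simp add: joins_def n)
  show ?thesis using st
  proof cases
    case (nstep_silent E K1 k ms1)
    note j' = j[unfolded n nstep_silent(1)]
    show ?thesis
      using nstep.nstep_silent[of E h r rm K k ms]
        joins_upd[OF j' nstep_silent(4) joins_active[OF j' nstep_silent(4,5)], of k ms1 ms]
        joins_engine_step[OF j' nstep_silent(4)] nstep_silent ok ms n engines_h
      by auto
  next
    case (nstep_send E K1 m k ms1)
    note j' = j[unfolded n nstep_send(1)]
    show ?thesis
      using nstep.nstep_send[of E h r rm K m k ms]
        joins_upd[OF j' nstep_send(4) joins_active[OF j' nstep_send(4,5)],
          of k "add_mset m ms1" "add_mset m ms"]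
        joins_engine_step[OF j' nstep_send(4)] nstep_send ok ms n engines_h
      by auto
  next
    case (nstep_receive E K1 m k ms1)
    note j' = j[unfolded n nstep_receive(1)]
    \<comment> \<open>The pool of \<open>h\<close> before the receipt is
      \<open>add_mset m (ms1 + snd n2)\<close>, so \<open>ms1 + snd n2\<close> is what
      remains.\<close>
    show ?thesis
      using nstep.nstep_receive[of E h r rm K m k "ms1 + snd n2"]
        joins_upd[OF j' nstep_receive(4) joins_active[OF j' nstep_receive(4,5)],
          of k ms1 "ms1 + snd n2"]
        joins_engine_step[OF j' nstep_receive(4)] nstep_receive ok ms n engines_h
      by auto
  next
    case (nstep_output a K1 d ms1)
    then have "nstep r rm h n \<alpha> (K, ms1 + snd n2)"
      using nstep.nstep_output[of a h r rm K d "ms1 + snd n2"] ms n iface_h by simp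
    then show ?thesis using j ok nstep_output n by (auto simp: joins_def)
  next
    case (nstep_input a b d K1 ms1)
    then have "nstep r rm h n \<alpha> (K, add_mset (b, d) ms)"
      using nstep.nstep_input[of a h b d rm r K ms] n iface_h conn_f iface_net_names[of Opp a f]
      by simp
    then show ?thesis using j ok nstep_input n ms by (auto simp: joins_def)
  qed
qed

text \<open>By \<open>conf_ok\<close>, the share of \<open>g\<close> holds only names of
  \<open>g\<close>, so a message with a name of \<open>f\<close> must come from the share of
  \<open>f\<close>.\<close>

lemma pool_take:
  assumes "joins r rm f g (K, add_mset m ms) (K1, ms1) n2" "fst m \<in> net_names f"
  obtains ms1' where "ms1 = add_mset m ms1'" "ms = ms1' + snd n2"
proof -
  have *: "add_mset m ms = ms1 + snd n2" and "m \<notin># snd n2"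
    using assms disj by (auto simp: joins_def conf_ok_def)
  then have "m \<in># ms1" by (metis union_iff union_single_eq_member)
  then obtain ms1' where "ms1 = add_mset m ms1'" by (blast dest: multi_member_split)
  with * that show thesis by simp
qed

text \<open>Converse of \<open>step_lift\<close>. The record update expresses that a step of
  \<open>h\<close> acts through an engine or external port of \<open>f\<close>, while still using
  the connection map of \<open>h\<close>.\<close>

lemma step_project:
  assumes j: "joins r rm f g n n1 n2"
    and st: "nstep r rm (h\<lparr>engines := engines f, iface := iface f\<rparr>) n \<alpha> n'"
  shows "\<exists>n1'. nstep r rm f n1 \<alpha> n1' \<and> joins r rm f g n' n1' n2"
proof -
  obtain K1 ms1 where n1: "n1 = (K1, ms1)" by (cases n1)
  \<comment> \<open>The invariant for \<open>n1'\<close> is left as a premise here;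
    \<open>nstep_conf_ok\<close> supplies it once for all cases.\<close>
  have "\<exists>n1'. nstep r rm f n1 \<alpha> n1' \<and> (conf_ok r rm f n1' \<longrightarrow> joins r rm f g n' n1' n2)"
    using st
  proof cases
    case (nstep_silent E K k ms)
    note j' = j[unfolded n1 nstep_silent(1)]
    have E: "E \<in> engines f" using nstep_silent by simp
    have e: "estep r rm (conn_of f) E (K1 E) None k"
      using joins_engine_step[OF j' E] nstep_silent by simp
    have "ms = ms1 + snd n2" using j' by (simp add: joins_def)
    then show ?thesis
      using nstep.nstep_silent[where K = K1, OF E e, of ms1]
        joins_upd[OF j' E joins_active[OF j' E e], of k ms1 ms]
      unfolding n1 nstep_silent by blast
  next
    case (nstep_send E K m k ms)
    note j' = j[unfolded n1 nstep_send(1)]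
    have E: "E \<in> engines f" using nstep_send by simp
    have e: "estep r rm (conn_of f) E (K1 E) (Some (Prop, m)) k"
      using joins_engine_step[OF j' E] nstep_send by simp
    have "add_mset m ms = add_mset m ms1 + snd n2" using j' by (simp add: joins_def)
    then show ?thesis
      using nstep.nstep_send[where K = K1, OF E e, of ms1]
        joins_upd[OF j' E joins_active[OF j' E e], of k "add_mset m ms1" "add_mset m ms"]
      unfolding n1 nstep_send by blast
  next
    case (nstep_receive E K m k ms)
    note j' = j[unfolded n1 nstep_receive(1)]
    have E: "E \<in> engines f" using nstep_receive by simp
    have e: "estep r rm (conn_of f) E (K1 E) (Some (Opp, m)) k"
      using joins_engine_step[OF j' E] nstep_receive by simp
    \<comment> \<open>The input port of the receiving engine shows that the message carries a name
      of \<open>f\<close>.\<close>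
    obtain ms1' where "ms1 = add_mset m ms1'" "ms = ms1' + snd n2"
      using pool_take[OF j'] eiface_net_names[OF E estep_receive_port[OF e]] by blast
    then show ?thesis
      using nstep.nstep_receive[where K = K1, OF E e, of ms1'] nstep_receive n1
        joins_upd[OF j' E joins_active[OF j' E e], of k ms1' ms]
      by auto
  next
    case (nstep_output a K d ms)
    note j' = j[unfolded n1 nstep_output(1)]
    have a: "(Prop, a) \<in> iface f" using nstep_output by simp
    obtain ms1' where "ms1 = add_mset (a, d) ms1'" "ms = ms1' + snd n2"
      using pool_take[OF j'] iface_net_names[OF a] by auto
    then show ?thesis
      using nstep.nstep_output[OF a, of r rm K1 d ms1'] j' nstep_output n1
      by (auto simp: joins_def)
  next
    case (nstep_input a b d K ms)
    then have a: "(Opp, a) \<in> iface f" and b: "conn_of f a = Some b" and d: "length d = rm"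
      using conn_f iface_net_names[of Opp a f] by auto
    show ?thesis
      using nstep.nstep_input[OF a b d, of r K1 ms1] j nstep_input n1
      by (auto simp: joins_def)
  qed
  moreover have "conf_ok r rm f n1" using j by (simp add: joins_def)
  ultimately show ?thesis using nstep_conf_ok[OF _ net_f rm_le] by blast
qed

text \<open>Each rule of \<open>nstep\<close> involves exactly one engine or one external port, and
  that belongs to \<open>f\<close> or to \<open>g\<close>.\<close>

lemma step_cases:
  assumes "nstep r rm h n \<alpha> n'"
  obtains "nstep r rm (h\<lparr>engines := engines f, iface := iface f\<rparr>) n \<alpha> n'"
  | "nstep r rm (h\<lparr>engines := engines g, iface := iface g\<rparr>) n \<alpha> n'"
proof -
  note intros = nstep.intros[where S = "h\<lparr>engines := engines X, iface := iface X\<rparr>" for X, simplified]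
  show thesis using assms that
    by cases (auto simp: engines_h iface_h intro: intros)
qed

section \<open>Runs as interleavings\<close>

text \<open>Replays \<open>f\<close> in \<open>h\<close> up to and including its next visible
  message, with \<open>g\<close> at rest. Quantifying over all continuations avoids a separate
  concatenation of runs.\<close>

lemma run_lift:
  assumes "run r rm f n1 (\<alpha> # t) n1'" "joins r rm f g n n1 n2"
  shows "\<exists>m m1. joins r rm f g m m1 n2 \<and> run r rm f m1 t n1' \<and>
    (\<forall>s m'. run r rm h m s m' \<longrightarrow> run r rm h n (\<alpha> # s) m')"
  using assms
proof (induction n1 "\<alpha> # t" n1' arbitrary: n rule: run.induct)
  case (run_silent n1 n1' n1'')
  then show ?case using step_lift[OF run_silent(4,1)] run.run_silent by meson
next
  case (run_obs n1 n1' n1'')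
  then show ?case using step_lift[OF run_obs(4,1)] run_obs(2) run.run_obs by meson
qed

lemma supp_disj: "supp (iface f) \<inter> supp (iface g) = {}"
  using disj by (auto simp: net_names_def)

interpretation sw: net_tensor r rm g f h by (rule swap)

text \<open>Each step of \<open>h\<close> moves one factor and leaves the other in place. A visible
  message has its port name in the support of the moving factor only, so exactly one of the two
  filters keeps it.\<close>

lemma run_project:
  assumes "run r rm h n s n'" "joins r rm f g n n1 n2"
  shows "s \<in> traces rm (iface h) \<and> (\<exists>n1'. run r rm f n1 (tr_minus s (iface g)) n1') \<and>
    (\<exists>n2'. run r rm g n2 (tr_minus s (iface f)) n2')"
  using assms
proof (induction arbitrary: n1 n2)
  case (run_nil n)
  show ?case using run.run_nil by (fastforce simp: traces_def tr_minus_def)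
next
  case (run_silent n n' s n'')
  from run_silent.hyps(1) show ?case
  proof (cases rule: step_cases)
    case 1
    then obtain n1' where "nstep r rm f n1 None n1'" "joins r rm f g n' n1' n2"
      using step_project run_silent.prems by blast
    then show ?thesis using run_silent.IH by (blast intro: run.run_silent)
  next
    case 2
    then obtain n2' where "nstep r rm g n2 None n2'" "joins r rm f g n' n1 n2'"
      using sw.step_project run_silent.prems joins_sym by blast
    then show ?thesis using run_silent.IH by (blast intro: run.run_silent)
  qed
next
  case (run_obs n \<alpha> n' s n'')
  obtain l a d where \<alpha>: "\<alpha> = (l, a, d)" by (cases \<alpha>)
  from run_obs.hyps(1) show ?case
  proof (cases rule: step_cases)
    case 1
    then obtain n1' where st: "nstep r rm f n1 (Some \<alpha>) n1'" and "joins r rm f g n' n1' n2"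
      using step_project run_obs.prems by blast
    then have IH: "s \<in> traces rm (iface h)" "\<exists>n1''. run r rm f n1' (tr_minus s (iface g)) n1''"
      "\<exists>n2'. run r rm g n2 (tr_minus s (iface f)) n2'"
      using run_obs.IH by blast+
    have "a \<in> supp (iface f)" "length d = rm"
      using nstep_label[OF st[unfolded \<alpha>]] run_obs.prems by (auto simp: joins_def intro: suppI)
    moreover from this have "a \<notin> supp (iface g)" using supp_disj by blast
    ultimately have "\<alpha> # s \<in> traces rm (iface h)"
      "tr_minus (\<alpha> # s) (iface g) = \<alpha> # tr_minus s (iface g)"
      "tr_minus (\<alpha> # s) (iface f) = tr_minus s (iface f)"
      using IH(1) by (auto simp: traces_def tr_minus_def iface_h \<alpha>)
    then show ?thesis using IH(2,3) run.run_obs[OF st] by metis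
  next
    case 2
    then obtain n2' where st: "nstep r rm g n2 (Some \<alpha>) n2'" and "joins r rm f g n' n1 n2'"
      using sw.step_project run_obs.prems joins_sym by blast
    then have IH: "s \<in> traces rm (iface h)" "\<exists>n1'. run r rm f n1 (tr_minus s (iface g)) n1'"
      "\<exists>n2''. run r rm g n2' (tr_minus s (iface f)) n2''"
      using run_obs.IH by blast+
    have "a \<in> supp (iface g)" "length d = rm"
      using nstep_label[OF st[unfolded \<alpha>]] run_obs.prems by (auto simp: joins_def intro: suppI)
    moreover from this have "a \<notin> supp (iface f)" using supp_disj by blast
    ultimately have "\<alpha> # s \<in> traces rm (iface h)"
      "tr_minus (\<alpha> # s) (iface f) = \<alpha> # tr_minus s (iface f)"
      "tr_minus (\<alpha> # s) (iface g) = tr_minus s (iface g)"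
      using IH(1) by (auto simp: traces_def tr_minus_def iface_h \<alpha>)
    then show ?thesis using IH(2,3) run.run_obs[OF st] by metis
  qed
qed

text \<open>The trace acts as the schedule: the factor owning the next message runs until it has
  performed it, while the other waits.\<close>

lemma run_merge:
  assumes "joins r rm f g n n1 n2" "s \<in> traces rm (iface h)"
    and "run r rm f n1 (tr_minus s (iface g)) n1'" "run r rm g n2 (tr_minus s (iface f)) n2'"
  shows "\<exists>n'. run r rm h n s n'"
  using assms
proof (induction s arbitrary: n n1 n2)
  case Nil
  then show ?case by (blast intro: run.run_nil)
next
  case (Cons \<alpha> s)
  obtain l a d where \<alpha>: "\<alpha> = (l, a, d)" by (cases \<alpha>)
  have s: "s \<in> traces rm (iface h)" and "a \<in> supp (iface f) \<union> supp (iface g)"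
    using Cons.prems(2) by (auto simp: traces_def iface_h \<alpha>)
  then consider "a \<in> supp (iface f)" "a \<notin> supp (iface g)"
    | "a \<in> supp (iface g)" "a \<notin> supp (iface f)"
    using supp_disj by blast
  then show ?case
  proof cases
    case 1
    then have "run r rm f n1 (\<alpha> # tr_minus s (iface g)) n1'"
      and g: "run r rm g n2 (tr_minus s (iface f)) n2'"
      using Cons.prems by (auto simp: tr_minus_def \<alpha>)
    with run_lift Cons.prems(1) obtain m m1 where "joins r rm f g m m1 n2"
      "run r rm f m1 (tr_minus s (iface g)) n1'"
      "\<forall>s m'. run r rm h m s m' \<longrightarrow> run r rm h n (\<alpha> # s) m'" by blast
    with Cons.IH s g show ?thesis by blast
  next
    case 2
    then have "run r rm g n2 (\<alpha> # tr_minus s (iface f)) n2'"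
      and f: "run r rm f n1 (tr_minus s (iface g)) n1'"
      using Cons.prems by (auto simp: tr_minus_def \<alpha>)
    with sw.run_lift Cons.prems(1) obtain m m2 where "joins r rm f g m n1 m2"
      "run r rm g m2 (tr_minus s (iface f)) n2'"
      "\<forall>s m'. run r rm h m s m' \<longrightarrow> run r rm h n (\<alpha> # s) m'"
      unfolding joins_sym[of r rm g f] by blast
    with Cons.IH s f show ?thesis by blast
  qed
qed

lemma denot_eq: "denot r rm h = interleave rm (iface f) (iface g) (denot r rm f) (denot r rm g)"
  using run_project[OF _ joins_initial] run_merge[OF joins_initial]
  unfolding denot_def interleave_def tensorI_def iface_h[symmetric] by blast

end

section \<open>The tensor of morphisms\<close>

text \<open>By \<open>is_net_conn\<close> each connection map is undefined outside the names of its
  net, so with disjoint names neither map overrides the other in \<open>++\<close>. The external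
  interfaces agree because \<open>dual\<close> distributes over unions.\<close>

lemma net_tensor_tensor_mor:
  assumes "rm \<le> r" "is_morphism f A B" "is_morphism g C D" "net_names f \<inter> net_names g = {}"
  shows "net_tensor r rm f g (tensor_mor A B C D f g)"
proof
  have f: "is_net f" "iface f = arrowI A B" and g: "is_net g" "iface g = arrowI C D"
    using assms by (auto simp: is_morphism_def)
  show "is_net f" "is_net g" by fact+
  show "iface (tensor_mor A B C D f g) = iface f \<union> iface g"
    unfolding f g by (auto simp: tensor_mor_def arrowI_def tensorI_def dual_def)
  show "conn_of (tensor_mor A B C D f g) a = conn_of f a" if "a \<in> net_names f" for a
    using that is_net_conn(1)[OF g(1), of a] assms(4)
    by (auto simp: tensor_mor_def map_add_def split: option.split)
  show "conn_of (tensor_mor A B C D f g) a = conn_of g a" if "a \<in> net_names g" for a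
    using that is_net_conn(1)[OF f(1), of a] assms(4)
    by (auto simp: tensor_mor_def map_add_def split: option.split)
qed (use assms in \<open>auto simp: tensor_mor_def\<close>)

theorem theorem2:
  fixes r rm :: nat
    and f g :: net
    and A B C D :: interface
  assumes "rm \<le> r"
    and "is_morphism f A B"
    and "is_morphism g C D"
    and "net_names f \<inter> net_names g = {}"
  shows "denot r rm (tensor_mor A B C D f g) =
         interleave rm (arrowI A B) (arrowI C D) (denot r rm f) (denot r rm g)"
  using net_tensor.denot_eq[OF net_tensor_tensor_mor[OF assms]] assms(2,3)
  by (simp add: is_morphism_def)

end
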